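(* For any two Dedekind cuts $(A|B)$, $(C|D)$, we have $$\tau\big((A|B)\boxtimes(C|D)\big)=\tau\big((A|B)\big)\,\widehat{\otimes}\,\tau\big((C|D)\big).$$
   Context: $\mathbb N=\{1,2,3,\dots\}$ and $\mathcal Z_{10}=\{0,1,\dots,9\}$. $\mathcal R$ is the set of all formal decimals $x=x_0.x_1x_2x_3\cdots$ with $x_0\in\mathbb Z$ and $x_k\in\mathcal Z_{10}$ for $k\in\mathbb N$; two elements are equal iff all their digits agree. For $k\in\mathbb N$, $[x]_k=\sum_{i=0}^k x_i10^{-i}\in\mathbb Q$. Order on $\mathcal R$: $x\preceq y$ iff $[x]_k\le [y]_k$ for all $k\in\mathbb N$. Every nonempty bounded above (below) subset of $(\mathcal R,\preceq)$ has a supremum (infimum); $\sup$ and $\inf$ are taken in $(\mathcal R,\preceq)$. $x\sim y$ ("no gap") means that there is no $z\in\mathcal R\setminus\{x,y\}$ lying strictly between $x$ and $y$ with respect to $\preceq$; $\sim$ is an equivalence relation, $\mathbb R:=\mathcal R/\sim$, and $[x]$ denotes the class of $x$. $\mathbb Q$ is regarded as a subset of $\mathcal R$ via long division: $\alpha=q/p$ ($p\in\mathbb N$, $q\in\mathbb Z$) is identified with $\alpha_0.\alpha_1\alpha_2\cdots$, where $\alpha_0=\lfloor q/p\rfloor$, $\beta_0=q-\alpha_0p$, $\alpha_{k+1}=\lfloor 10\beta_k/p\rfloor$, $\beta_{k+1}=10\beta_k-\alpha_{k+1}p$. For a bounded sequence $\{x^{(n)}\}_{n\in\mathbb N}$ in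 $\mathcal R$: $\overline{\mathrm{LIMIT}}(\{x^{(n)}\})=\inf\{\sup\{x^{(k)}: k\ge n\}: n\in\mathbb N\}$ and $\underline{\mathrm{LIMIT}}(\{x^{(n)}\})=\sup\{\inf\{x^{(k)}: k\ge n\}: n\in\mathbb N\}$; if they are equal, the common value is denoted $\mathrm{LIMIT}(\{x^{(n)}\})$. It exists for bounded monotone sequences. On $\mathcal R$: $\Psi(x_0.x_1x_2x_3\cdots)=(-1-x_0).(9-x_1)(9-x_2)(9-x_3)\cdots$; $\Psi^{(k)}$ is the $k$-fold composite ($\Psi^{(0)}=\mathrm{id}$); $\|x\|=\max\{x,\Psi(x)\}$; $\mathrm{sign}(x)=0$ if $x\succeq 0.000000\cdots$ and $\mathrm{sign}(x)=1$ if $x\preceq(-1).999999\cdots$. Multiplication: $x\otimes y=\Psi^{(\mathrm{sign}(x)+\mathrm{sign}(y))}\big(\mathrm{LIMIT}(\{[\|x\|]_k\cdot[\|y\|]_k\}_{k\in\mathbb N})\big)$, products taken in $\mathbb Q$. It respects $\sim$, and $[x]\,\widehat\otimes\,[y]:=[x\otimes y]$ on $\mathbb R$. A Dedekind cut $(A|B)$ is a pair of nonempty subsets $A,B$ of $\mathbb Q$ such that $A\cap B=\emptyset$, $A\cup B=\mathbb Q$; $a<b$ for all $a\in A$, $b\in B$; and $A$ contains no greatest element. $\mathbf{DR}$ is the set of all Dedekind cuts. For every Dedekind cut $\sup A\sim\inf B$, and $\tau:\mathbf{DR}\to\mathbb R$ is $\tau((A|B))=[\sup A]=[\inf B]$.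 A generalized Dedekind cut $[A\Rsh B]$ is a pair satisfying the same conditions except that $A$ may have a greatest element; it is identified with the Dedekind cut obtained by moving the greatest element of $A$, if it exists, from $A$ to $B$. On $\mathbf{DR}$: $\widetilde\Psi((A|B))=[-B\Rsh -A]$, with $\widetilde\Psi^{(k)}$ its $k$-fold composite; $\Theta((A|B))=\max_{x\in B}\mathrm{sign}(x)\in\{0,1\}$ (the sign of the cut); $\|(A|B)\|=\widetilde\Psi^{(\Theta((A|B)))}((A|B))$. If $(A|B)$ and $(C|D)$ both have sign zero, $(A|B)\boxtimes(C|D)=[\mathbb Q\setminus(B\cdot D)\Rsh B\cdot D]$, where $B\cdot D=\{bd: b\in B,d\in D\}$. In general, $(A|B)\boxtimes(C|D)=\widetilde\Psi^{(\Theta((A|B))+\Theta((C|D)))}\big(\|(A|B)\|\boxtimes\|(C|D)\|\big)$. *)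

theory Defs
  imports Complex_Main
begin

subsection \<open>Formal decimals\<close>

text \<open>A formal decimal is its digit sequence; index 0 holds the integer part. So
  \<open>(-1).3000\<dots>\<close> stands for \<open>-1 + 0.3\<close>, not for \<open>-1.3\<close>. Both \<open>0.999\<dots>\<close> and \<open>1.000\<dots>\<close> are
  elements, and they are different.\<close>

typedef decimal = "{x :: nat \<Rightarrow> int. \<forall>k\<ge>1. x k \<in> {0..9}}"
  morphisms digit Abs_decimal
  by (rule exI[of _ "\<lambda>_. 0"]) auto

setup_lifting type_definition_decimal

definition trunc :: "decimal \<Rightarrow> nat \<Rightarrow> rat" where
  "trunc x k = (\<Sum>i=0..k. of_int (digit x i) / 10 ^ i)"

lemma digit_bounds: "0 \<le> digit x (Suc k)" "digit x (Suc k) \<le> 9"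
  using digit[of x] by auto

lemma decimal_eqI: "(\<And>k. digit x k = digit y k) \<Longrightarrow> x = y"
  by (metis digit_inject ext)

text \<open>Truncations scaled to integers, \<open>scl x k = 10 ^ k * trunc x k\<close>; used in proofs only.\<close>

primrec scl :: "decimal \<Rightarrow> nat \<Rightarrow> int" where
  "scl x 0 = digit x 0"
| "scl x (Suc k) = 10 * scl x k + digit x (Suc k)"

lemma trunc_scl: "trunc x k = of_int (scl x k) / 10 ^ k"
proof (induction k)
  case (Suc k)
  have "trunc x (Suc k) = trunc x k + of_int (digit x (Suc k)) / 10 ^ Suc k"
    by (simp add: trunc_def)
  then show ?case
    by (simp add: Suc.IH field_simps)
qed (simp add: trunc_def)

lemma trunc_le_iff: "trunc x k \<le> trunc y k \<longleftrightarrow> scl x k \<le> scl y k"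
  by (simp add: trunc_scl divide_le_cancel)

lemma scl_inject: assumes "\<And>k. scl x k = scl y k" shows "x = y"
proof (rule decimal_eqI)
  fix k show "digit x k = digit y k"
    using assms[of k] assms[of "k - 1"] by (cases k) auto
qed

lemma scl_less_mono:
  assumes "scl x k < scl y k" "k \<le> j" shows "scl x j < scl y j"
  using assms(2)
proof (induction j rule: dec_induct)
  case (step n)
  then show ?case using digit_bounds[of x n] digit_bounds[of y n] by simp
qed (use assms in simp)

lemma scl_le_back:
  assumes "scl x j \<le> scl y j" "k \<le> j" shows "scl x k \<le> scl y k"
  using scl_less_mono[of y k x j] assms by linarith

lemma scl_exists:
  fixes M :: "nat \<Rightarrow> int"
  assumes "\<And>k. 10 * M k \<le> M (Suc k)" "\<And>k. M (Suc k) \<le> 10 * M k + 9"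
  shows "\<exists>x. \<forall>k. scl x k = M k"
proof -
  define d where "d = (\<lambda>k. case k of 0 \<Rightarrow> M 0 | Suc j \<Rightarrow> M (Suc j) - 10 * M j)"
  have "d k \<in> {0..9}" if "k \<ge> 1" for k
    using that assms[of "k - 1"] by (cases k) (auto simp: d_def)
  then have dig: "digit (Abs_decimal d) = d"
    by (intro Abs_decimal_inverse) auto
  have "d 0 = M 0" "\<And>k. d (Suc k) = M (Suc k) - 10 * M k"
    by (simp_all add: d_def)
  then have "scl (Abs_decimal d) k = M k" for k
    by (induction k) (simp_all add: dig)
  then show ?thesis by blast
qed

instantiation decimal :: linorder
begin

definition less_eq_decimal :: "decimal \<Rightarrow> decimal \<Rightarrow> bool" where
  "x \<le> y \<longleftrightarrow> (\<forall>k\<ge>1. trunc x k \<le> trunc y k)"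

definition less_decimal :: "decimal \<Rightarrow> decimal \<Rightarrow> bool" where
  "x < y \<longleftrightarrow> x \<le> y \<and> x \<noteq> (y :: decimal)"

lemma le_scl: "x \<le> y \<longleftrightarrow> (\<forall>k. scl x k \<le> scl y k)"
proof
  assume *: "x \<le> y"
  show "\<forall>k. scl x k \<le> scl y k"
  proof
    fix k
    have "scl x (Suc k) \<le> scl y (Suc k)"
      using * by (auto simp: less_eq_decimal_def trunc_le_iff)
    then show "scl x k \<le> scl y k" by (rule scl_le_back) simp
  qed
qed (simp add: less_eq_decimal_def trunc_le_iff)

instance
proof
  fix x y z :: decimal
  show antisym: "x = y" if "x \<le> y" "y \<le> x"
    using that by (intro scl_inject) (auto simp: le_scl intro: antisym)
  show "(x < y) = (x \<le> y \<and> \<not> y \<le> x)"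
    unfolding less_decimal_def using scl_inject[of x y] by (auto simp: le_scl intro: antisym)
  show "x \<le> x" by (simp add: le_scl)
  show "x \<le> z" if "x \<le> y" "y \<le> z"
    using that by (auto simp: le_scl intro: order_trans)
  show "x \<le> y \<or> y \<le> x"
  proof (rule ccontr)
    assume "\<not> (x \<le> y \<or> y \<le> x)"
    then obtain j k where "scl y j < scl x j" "scl x k < scl y k"
      by (auto simp: le_scl not_le)
    then show False
      using scl_less_mono[of y j x, OF _ max.cobounded1[of j k]]
        scl_less_mono[of x k y, OF _ max.cobounded2[of k j]] by linarith
  qed
qed

end

lemma less_scl: "x < y \<longleftrightarrow> (\<exists>k. scl x k < scl y k)"
  by (meson le_scl linorder_not_le)

text \<open>\<open>Sup\<close> and \<open>Inf\<close> are the least upper and greatest lower bound. They exist for nonempty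
  sets bounded on the appropriate side; on other sets the descriptions denote nothing.\<close>

instantiation decimal :: conditionally_complete_linorder
begin

definition inf_decimal :: "decimal \<Rightarrow> decimal \<Rightarrow> decimal" where
  "inf_decimal = min"

definition sup_decimal :: "decimal \<Rightarrow> decimal \<Rightarrow> decimal" where
  "sup_decimal = max"

definition Sup_decimal :: "decimal set \<Rightarrow> decimal" where
  "Sup (S :: decimal set) = (THE z. (\<forall>x\<in>S. x \<le> z) \<and> (\<forall>u. (\<forall>x\<in>S. x \<le> u) \<longrightarrow> z \<le> u))"

definition Inf_decimal :: "decimal set \<Rightarrow> decimal" where
  "Inf (S :: decimal set) = (THE z. (\<forall>x\<in>S. z \<le> x) \<and> (\<forall>u. (\<forall>x\<in>S. u \<le> x) \<longrightarrow> u \<le> z))"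

lemma int_bdd_above_has_max:
  fixes T :: "int set"
  assumes "T \<noteq> {}" "\<And>t. t \<in> T \<Longrightarrow> t \<le> b"
  shows "\<exists>m\<in>T. \<forall>t\<in>T. t \<le> m"
proof -
  obtain t0 where "t0 \<in> T" using assms by blast
  define m where "m = Max (T \<inter> {t0..b})"
  have fin: "finite (T \<inter> {t0..b})" by simp
  have ne: "T \<inter> {t0..b} \<noteq> {}" using \<open>t0 \<in> T\<close> assms by fastforce
  have "m \<in> T" using Max_in[OF fin ne] by (simp add: m_def)
  moreover have "t \<le> m" if "t \<in> T" for t
  proof (cases "t0 \<le> t")
    case True
    then show ?thesis using that assms fin by (auto simp: m_def intro!: Max_ge)
  next
    case False
    moreover have "t0 \<le> m" using Max_in[OF fin ne] by (simp add: m_def)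
    ultimately show ?thesis by simp
  qed
  ultimately show ?thesis by blast
qed

lemma decimal_lub_exists:
  fixes S :: "decimal set"
  assumes ne: "S \<noteq> {}" and ub: "\<forall>x\<in>S. x \<le> b"
  shows "\<exists>z. (\<forall>x\<in>S. x \<le> z) \<and> (\<forall>u. (\<forall>x\<in>S. x \<le> u) \<longrightarrow> z \<le> u)"
proof -
  have "\<exists>m. m \<in> S \<and> (\<forall>x\<in>S. scl x k \<le> scl m k)" for k
    using int_bdd_above_has_max[of "(\<lambda>x. scl x k) ` S" "scl b k"] ne ub
    by (auto simp: le_scl)
  then obtain m where m: "\<And>k. m k \<in> S" "\<And>k x. x \<in> S \<Longrightarrow> scl x k \<le> scl (m k) k"
    by metis
  have "\<exists>z. \<forall>k. scl z k = scl (m k) k"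
  proof (rule scl_exists)
    fix k
    show "10 * scl (m k) k \<le> scl (m (Suc k)) (Suc k)"
      using m(2)[OF m(1), of k "Suc k"] digit_bounds[of "m k" k] by simp
    show "scl (m (Suc k)) (Suc k) \<le> 10 * scl (m k) k + 9"
      using m(2)[OF m(1), of "Suc k" k] digit_bounds[of "m (Suc k)" k] by simp
  qed
  then obtain z where z: "\<And>k. scl z k = scl (m k) k" by blast
  have "\<forall>x\<in>S. x \<le> z" using m(2) by (auto simp: le_scl z)
  moreover have "z \<le> u" if "\<forall>x\<in>S. x \<le> u" for u
    using that m(1) by (auto simp: le_scl z)
  ultimately show ?thesis by blast
qed

lemma decimal_glb_exists:
  fixes S :: "decimal set"
  assumes ne: "S \<noteq> {}" and lb: "\<forall>x\<in>S. b \<le> x"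
  shows "\<exists>z. (\<forall>x\<in>S. z \<le> x) \<and> (\<forall>u. (\<forall>x\<in>S. u \<le> x) \<longrightarrow> u \<le> z)"
proof -
  let ?L = "{u. \<forall>x\<in>S. u \<le> x}"
  obtain s where "s \<in> S" using ne by blast
  then have "\<exists>z. (\<forall>x\<in>?L. x \<le> z) \<and> (\<forall>u. (\<forall>x\<in>?L. x \<le> u) \<longrightarrow> z \<le> u)"
    using lb by (intro decimal_lub_exists[of _ s]) auto
  then show ?thesis by blast
qed

instance
proof
  fix x y z :: decimal and X :: "decimal set"
  show "inf x y \<le> x" "inf x y \<le> y" "x \<le> sup x y" "y \<le> sup x y"
    by (simp_all add: inf_decimal_def sup_decimal_def)
  show "x \<le> inf y z" if "x \<le> y" "x \<le> z" using that by (simp add: inf_decimal_def)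
  show "sup y z \<le> x" if "y \<le> x" "z \<le> x" using that by (simp add: sup_decimal_def)
  have glb: "(\<forall>x\<in>X. Inf X \<le> x) \<and> (\<forall>u. (\<forall>x\<in>X. u \<le> x) \<longrightarrow> u \<le> Inf X)"
    if ne: "X \<noteq> {}" and bdd: "bdd_below X"
  proof -
    have "\<exists>!z. (\<forall>x\<in>X. z \<le> x) \<and> (\<forall>u. (\<forall>x\<in>X. u \<le> x) \<longrightarrow> u \<le> z)"
    proof (rule ex_ex1I)
      obtain b where "\<forall>x\<in>X. b \<le> x" using bdd by (auto simp: bdd_below_def)
      then show "\<exists>z. (\<forall>x\<in>X. z \<le> x) \<and> (\<forall>u. (\<forall>x\<in>X. u \<le> x) \<longrightarrow> u \<le> z)"
        by (rule decimal_glb_exists[OF ne])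
    qed (blast intro: order.antisym)
    from theI'[OF this] show ?thesis unfolding Inf_decimal_def .
  qed
  have lub: "(\<forall>x\<in>X. x \<le> Sup X) \<and> (\<forall>u. (\<forall>x\<in>X. x \<le> u) \<longrightarrow> Sup X \<le> u)"
    if ne: "X \<noteq> {}" and bdd: "bdd_above X"
  proof -
    have "\<exists>!z. (\<forall>x\<in>X. x \<le> z) \<and> (\<forall>u. (\<forall>x\<in>X. x \<le> u) \<longrightarrow> z \<le> u)"
    proof (rule ex_ex1I)
      obtain b where "\<forall>x\<in>X. x \<le> b" using bdd by (auto simp: bdd_above_def)
      then show "\<exists>z. (\<forall>x\<in>X. x \<le> z) \<and> (\<forall>u. (\<forall>x\<in>X. x \<le> u) \<longrightarrow> z \<le> u)"
        by (rule decimal_lub_exists[OF ne])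
    qed (blast intro: order.antisym)
    from theI'[OF this] show ?thesis unfolding Sup_decimal_def .
  qed
  show "Inf X \<le> x" if "x \<in> X" "bdd_below X" using glb that by blast
  show "z \<le> Inf X" if "X \<noteq> {}" "\<And>x. x \<in> X \<Longrightarrow> z \<le> x"
    using glb that by (auto simp: bdd_below_def)
  show "x \<le> Sup X" if "x \<in> X" "bdd_above X" using lub that by blast
  show "Sup X \<le> z" if "X \<noteq> {}" "\<And>x. x \<in> X \<Longrightarrow> x \<le> z"
    using lub that by (auto simp: bdd_above_def)
qed

end


subsection \<open>Rational numbers as formal decimals\<close>

primrec ld_rem :: "int \<Rightarrow> int \<Rightarrow> nat \<Rightarrow> int" where
  "ld_rem q p 0 = q - \<lfloor>of_int q / of_int p :: rat\<rfloor> * p"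
| "ld_rem q p (Suc k) = 10 * ld_rem q p k - \<lfloor>10 * of_int (ld_rem q p k) / of_int p :: rat\<rfloor> * p"

primrec ld_digit :: "int \<Rightarrow> int \<Rightarrow> nat \<Rightarrow> int" where
  "ld_digit q p 0 = \<lfloor>of_int q / of_int p :: rat\<rfloor>"
| "ld_digit q p (Suc k) = \<lfloor>10 * of_int (ld_rem q p k) / of_int p :: rat\<rfloor>"

lemma floor_10_div: "\<lfloor>10 * of_int a / of_int b :: rat\<rfloor> = 10 * a div b"
  using floor_divide_of_int_eq[of "10 * a" b, where 'a = rat] by simp

lemma ld_rem_bounds: assumes "p > 0" shows "0 \<le> ld_rem q p k \<and> ld_rem q p k < p"
  using assms by (cases k) (simp_all add: floor_10_div floor_divide_of_int_eq minus_div_mult_eq_mod)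

lemma ld_digit_range: assumes "p > 0" "k \<ge> 1" shows "ld_digit q p k \<in> {0..9}"
proof (cases k)
  case (Suc j)
  have "0 \<le> 10 * ld_rem q p j" "10 * ld_rem q p j < 10 * p"
    using ld_rem_bounds[OF assms(1), of q j] by auto
  then have "0 \<le> 10 * ld_rem q p j div p"
    using assms(1) by (simp add: pos_imp_zdiv_nonneg_iff)
  moreover have "10 * ld_rem q p j div p < 10"
  proof (rule ccontr)
    assume "\<not> ?thesis"
    then have "10 * p \<le> 10 * ld_rem q p j div p * p"
      using assms(1) by (intro mult_right_mono) auto
    also have "\<dots> \<le> 10 * ld_rem q p j"
      using div_mult_mod_eq[of "10 * ld_rem q p j" p] pos_mod_sign[OF assms(1), of "10 * ld_rem q p j"]
      by linarith
    finally show False using \<open>10 * ld_rem q p j < 10 * p\<close> by simp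
  qed
  ultimately show ?thesis by (simp add: Suc floor_10_div)
qed (use assms in simp)

text \<open>Long division is run on the reduced fraction; by \<open>digit_dec_of_rat_Fract\<close> below any other
  representation with positive denominator yields the same digits.\<close>

lift_definition dec_of_rat :: "rat \<Rightarrow> decimal" is
  "\<lambda>r. ld_digit (fst (quotient_of r)) (snd (quotient_of r))"
  using ld_digit_range quotient_of_denom_pos' by blast

lemma ld_scale:
  assumes "c > 0"
  shows "ld_rem (c * q) (c * p) k = c * ld_rem q p k" "ld_digit (c * q) (c * p) k = ld_digit q p k"
proof -
  have dig: "\<lfloor>10 * of_int (c * a) / of_int (c * p) :: rat\<rfloor> = \<lfloor>10 * of_int a / of_int p :: rat\<rfloor>" for a
    using assms by simp
  show rem: "ld_rem (c * q) (c * p) k = c * ld_rem q p k" for k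
  proof (induction k)
    case (Suc k)
    then show ?case
      by (simp only: ld_rem.simps dig) (simp add: algebra_simps)
  qed (use assms in \<open>simp add: algebra_simps\<close>)
  show "ld_digit (c * q) (c * p) k = ld_digit q p k"
    by (cases k) (use assms in \<open>simp_all only: ld_digit.simps rem dig\<close>, simp)
qed

lemma digit_dec_of_rat_Fract:
  assumes "p > 0" shows "digit (dec_of_rat (Fract q p)) k = ld_digit q p k"
proof -
  define g where "g = gcd q p"
  have g: "g > 0" using assms by (simp add: g_def gcd_pos_int)
  have "quotient_of (Fract q p) = (q div g, p div g)"
    using assms by (simp add: quotient_of_Fract Rat.normalize_def Let_def g_def)
  moreover have "g * (q div g) = q" "g * (p div g) = p" by (simp_all add: g_def)
  ultimately show ?thesis
    using ld_scale(2)[OF g, of "q div g" "p div g" k] by (simp add: dec_of_rat.rep_eq)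
qed

lemma scl_dec_of_rat: "scl (dec_of_rat r) k = \<lfloor>10 ^ k * r\<rfloor>"
proof -
  obtain q p where qp: "quotient_of r = (q, p)" by fastforce
  then have p: "p > 0" and r: "r = of_int q / of_int p"
    by (auto simp: quotient_of_denom_pos quotient_of_div)
  have "scl (dec_of_rat r) k * p + ld_rem q p k = 10 ^ k * q"
    by (induction k) (simp_all add: dec_of_rat.rep_eq qp algebra_simps)
  moreover have "(scl (dec_of_rat r) k * p + ld_rem q p k) div p = scl (dec_of_rat r) k"
    using ld_rem_bounds[OF p, of q k] p by simp
  moreover have "\<lfloor>10 ^ k * r\<rfloor> = (10 ^ k * q) div p"
    using floor_divide_of_int_eq[of "10 ^ k * q" p, where 'a = rat] by (simp add: r)
  ultimately show ?thesis by simp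
qed

lemma dec_of_rat_mono: "r \<le> s \<Longrightarrow> dec_of_rat r \<le> dec_of_rat s"
  unfolding le_scl scl_dec_of_rat by (auto intro!: floor_mono mult_left_mono)


subsection \<open>The real value of a formal decimal\<close>

text \<open>An auxiliary notion, needed only to show that the operations below are well defined.\<close>

definition val :: "decimal \<Rightarrow> real" where
  "val x = (SUP k. of_int (scl x k) / 10 ^ k)"

lemma scl_frac_mono: "k \<le> j \<Longrightarrow> real_of_int (scl x k) / 10 ^ k \<le> of_int (scl x j) / 10 ^ j"
proof (induction j rule: dec_induct)
  case (step n)
  have "real_of_int (scl x n) / 10 ^ n \<le> of_int (scl x (Suc n)) / 10 ^ Suc n"
    using digit_bounds[of x n] by (simp add: field_simps)
  then show ?case using step by linarith
qed simp

lemma scl_frac_antimono: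
  "k \<le> j \<Longrightarrow> (real_of_int (scl x j) + 1) / 10 ^ j \<le> (of_int (scl x k) + 1) / 10 ^ k"
proof (induction j rule: dec_induct)
  case (step n)
  have "real_of_int (digit x (Suc n)) \<le> 9" using digit_bounds[of x n] by linarith
  then have "(real_of_int (scl x (Suc n)) + 1) / 10 ^ Suc n \<le> (of_int (scl x n) + 1) / 10 ^ n"
    by (simp add: field_simps)
  then show ?case using step by linarith
qed simp

lemma scl_frac_le: "real_of_int (scl x j) / 10 ^ j \<le> (of_int (scl x k) + 1) / 10 ^ k"
proof -
  have "real_of_int (scl x j) / 10 ^ j \<le> of_int (scl x (max j k)) / 10 ^ max j k"
    by (rule scl_frac_mono) simp
  also have "\<dots> \<le> (of_int (scl x (max j k)) + 1) / 10 ^ max j k"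
    by (simp add: divide_right_mono)
  also have "\<dots> \<le> (of_int (scl x k) + 1) / 10 ^ k"
    by (rule scl_frac_antimono) simp
  finally show ?thesis .
qed

lemma val_lower: "of_int (scl x k) / 10 ^ k \<le> val x"
  unfolding val_def by (rule cSUP_upper) (auto intro!: bdd_aboveI2[OF scl_frac_le[of x _ 0]])

lemma val_upper: "val x \<le> (of_int (scl x k) + 1) / 10 ^ k"
  unfolding val_def by (rule cSUP_least) (auto intro: scl_frac_le[of x _ k, simplified])

lemma inverse_10_tendsto_0: "(\<lambda>k. 1 / 10 ^ k :: real) \<longlonglongrightarrow> 0"
  using LIMSEQ_power_zero[of "1/10 :: real"] by (simp add: power_one_over)

lemma scl_tendsto_val: "(\<lambda>k. of_int (scl x k) / 10 ^ k) \<longlonglongrightarrow> val x"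
proof (rule tendsto_sandwich)
  show "(\<lambda>k. val x - 1 / 10 ^ k) \<longlonglongrightarrow> val x"
    using tendsto_diff[OF tendsto_const[of "val x"] inverse_10_tendsto_0] by simp
  show "\<forall>\<^sub>F k in sequentially. val x - 1 / 10 ^ k \<le> real_of_int (scl x k) / 10 ^ k"
    using val_upper[of x] by (simp add: add_divide_distrib algebra_simps)
  show "\<forall>\<^sub>F k in sequentially. real_of_int (scl x k) / 10 ^ k \<le> val x"
    using val_lower by simp
qed simp

lemma val_unique:
  assumes "\<And>k. \<bar>v - of_int (scl x k) / 10 ^ k\<bar> \<le> 1 / 10 ^ k"
  shows "val x = v"
proof -
  have "(\<lambda>k. of_int (scl x k) / 10 ^ k) \<longlonglongrightarrow> v"
  proof (rule tendsto_sandwich)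
    show "(\<lambda>k. v - 1 / 10 ^ k) \<longlonglongrightarrow> v"
      using tendsto_diff[OF tendsto_const[of v] inverse_10_tendsto_0] by simp
    show "(\<lambda>k. v + 1 / 10 ^ k) \<longlonglongrightarrow> v"
      using tendsto_add[OF tendsto_const[of v] inverse_10_tendsto_0] by simp
    show "\<forall>\<^sub>F k in sequentially. v - 1 / 10 ^ k \<le> of_int (scl x k) / 10 ^ k"
      using assms by (auto simp: abs_le_iff algebra_simps)
    show "\<forall>\<^sub>F k in sequentially. of_int (scl x k) / 10 ^ k \<le> v + 1 / 10 ^ k"
    proof (rule always_eventually, rule allI)
      fix k show "of_int (scl x k) / 10 ^ k \<le> v + 1 / 10 ^ k"
        using assms[of k] by linarith
    qed
  qed
  then show ?thesis using LIMSEQ_unique scl_tendsto_val by blast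
qed

lemma val_mono: "x \<le> y \<Longrightarrow> val x \<le> val y"
  by (rule LIMSEQ_le[OF scl_tendsto_val scl_tendsto_val])
    (auto simp: le_scl intro!: divide_right_mono)

lemma val_dec_of_rat: "val (dec_of_rat r) = of_rat r"
proof (rule val_unique)
  fix k
  have "of_int (scl (dec_of_rat r) k) \<le> 10 ^ k * r" "10 ^ k * r \<le> of_int (scl (dec_of_rat r) k) + 1"
    unfolding scl_dec_of_rat by linarith+
  then have "of_rat (of_int (scl (dec_of_rat r) k)) \<le> (of_rat (10 ^ k * r) :: real)"
    "of_rat (10 ^ k * r) \<le> (of_rat (of_int (scl (dec_of_rat r) k) + 1) :: real)"
    unfolding of_rat_less_eq .
  then have *: "real_of_int (scl (dec_of_rat r) k) \<le> 10 ^ k * of_rat r"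
    "10 ^ k * of_rat r \<le> real_of_int (scl (dec_of_rat r) k) + 1"
    by (simp_all add: of_rat_mult of_rat_add of_rat_power)
  have "real_of_int (scl (dec_of_rat r) k) / 10 ^ k \<le> of_rat r"
    "of_rat r \<le> (real_of_int (scl (dec_of_rat r) k) + 1) / 10 ^ k"
    using * by (simp_all add: divide_le_eq le_divide_eq mult.commute)
  then show "\<bar>of_rat r - real_of_int (scl (dec_of_rat r) k) / 10 ^ k\<bar> \<le> 1 / 10 ^ k"
    by (simp add: add_divide_distrib abs_le_iff)
qed

lemma val_eq_no_between:
  assumes "x < z" "z < y" shows "val x < val y"
proof (rule ccontr)
  assume "\<not> val x < val y"
  then have eq: "val x = val z" "val y = val z"
    using less_imp_le[OF assms(1)] less_imp_le[OF assms(2)] val_mono[of x z] val_mono[of z y] by linarith+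
  obtain i j where "scl x i < scl z i" "scl z j < scl y j"
    using assms by (auto simp: less_scl)
  define k where "k = max i j"
  have k: "scl x k < scl z k" "scl z k < scl y k"
    using scl_less_mono[OF \<open>scl x i < scl z i\<close>, of k] scl_less_mono[OF \<open>scl z j < scl y j\<close>, of k]
    by (auto simp: k_def)
  then have "(real_of_int (scl x k) + 1) / 10 ^ k < of_int (scl y k) / 10 ^ k"
    by (intro divide_strict_right_mono) auto
  then show False using val_upper[of x k] val_lower[of y k] eq by linarith
qed


subsection \<open>Gaps and the real numbers\<close>

definition no_gap :: "decimal \<Rightarrow> decimal \<Rightarrow> bool" where
  "no_gap x y \<longleftrightarrow> \<not> (\<exists>z. z \<notin> {x, y} \<and> (x \<le> z \<and> z \<le> y \<or> y \<le> z \<and> z \<le> x))"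

lemma no_gap_iff_val: "no_gap x y \<longleftrightarrow> val x = val y"
proof
  have less: "\<exists>z. x < z \<and> z < y" if lt: "val x < val y" for x y
  proof -
    obtain r where "val x < of_rat r" "of_rat r < val y" using of_rat_dense[OF lt] by blast
    then show ?thesis by (metis val_dec_of_rat val_mono not_le)
  qed
  show "val x = val y" if "no_gap x y"
  proof (rule ccontr)
    assume "val x \<noteq> val y"
    then obtain z where "x < z \<and> z < y \<or> y < z \<and> z < x" using less by (meson linorder_neqE)
    then show False using that by (auto simp: no_gap_def)
  qed
next
  assume "val x = val y"
  then show "no_gap x y"
    using val_eq_no_between unfolding no_gap_def by (fastforce simp: order.order_iff_strict)
qed

quotient_type dreal = decimal / no_gap
  morphisms rep_dreal dreal_class
  by (rule equivpI) (auto simp: no_gap_iff_val intro!: reflpI sympI transpI)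


subsection \<open>Limits\<close>

text \<open>Sequences are indexed by the positive integers; the value at index 0 is ignored. The
  following are meaningful for bounded sequences only, as \<open>Sup\<close> and \<open>Inf\<close> are.\<close>

definition LIMIT_upper :: "(nat \<Rightarrow> decimal) \<Rightarrow> decimal" where
  "LIMIT_upper X = (INF n\<in>{1..}. SUP k\<in>{n..}. X k)"

definition LIMIT_lower :: "(nat \<Rightarrow> decimal) \<Rightarrow> decimal" where
  "LIMIT_lower X = (SUP n\<in>{1..}. INF k\<in>{n..}. X k)"

definition LIMIT :: "(nat \<Rightarrow> decimal) \<Rightarrow> decimal" where
  "LIMIT X = (THE z. LIMIT_upper X = z \<and> LIMIT_lower X = z)"

lemma LIMIT_mono:
  assumes mono: "\<And>j k. 1 \<le> j \<Longrightarrow> j \<le> k \<Longrightarrow> X j \<le> X k" and ub: "\<And>k. k \<ge> 1 \<Longrightarrow> X k \<le> b"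
  shows "LIMIT_upper X = (SUP k\<in>{1..}. X k)" "LIMIT_lower X = (SUP k\<in>{1..}. X k)"
    "LIMIT X = (SUP k\<in>{1..}. X k)"
proof -
  have bdd: "bdd_above (X ` {n..})" if "n \<ge> 1" for n
    using that ub by (intro bdd_aboveI2[of _ _ b]) auto
  have S: "(SUP k\<in>{n..}. X k) = (SUP k\<in>{1..}. X k)" if "n \<ge> 1" for n
  proof (rule antisym)
    show "(SUP k\<in>{n..}. X k) \<le> (SUP k\<in>{1..}. X k)"
      using that by (intro cSUP_subset_mono bdd) auto
    show "(SUP k\<in>{1..}. X k) \<le> (SUP k\<in>{n..}. X k)"
    proof (rule cSUP_least)
      fix k :: nat assume "k \<in> {1..}"
      then have "X k \<le> X (max k n)" by (intro mono) auto
      also have "\<dots> \<le> (SUP k\<in>{n..}. X k)" by (intro cSUP_upper bdd that) auto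
      finally show "X k \<le> (SUP k\<in>{n..}. X k)" .
    qed simp
  qed
  have I: "(INF k\<in>{n..}. X k) = X n" if "n \<ge> 1" for n
    using that by (intro cInf_eq_minimum) (auto intro: mono)
  show u: "LIMIT_upper X = (SUP k\<in>{1..}. X k)"
  proof -
    have "LIMIT_upper X = (INF n\<in>{1::nat..}. SUP k\<in>{1..}. X k)"
      unfolding LIMIT_upper_def by (rule INF_cong) (auto intro: S[simplified])
    then show ?thesis by (subst (asm) cINF_const) auto
  qed
  show l: "LIMIT_lower X = (SUP k\<in>{1..}. X k)"
    unfolding LIMIT_lower_def by (rule SUP_cong) (use I in auto)
  show "LIMIT X = (SUP k\<in>{1..}. X k)"
    unfolding LIMIT_def u l by blast
qed

lemma val_Sup:
  assumes "S \<noteq> {}" "bdd_above S" shows "val (Sup S) = (SUP x\<in>S. val x)"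
proof (rule antisym)
  have bdd: "bdd_above (val ` S)"
    using assms by (auto simp: bdd_above_def intro: val_mono)
  show "(SUP x\<in>S. val x) \<le> val (Sup S)"
    using assms by (intro cSUP_least val_mono cSup_upper) auto
  show "val (Sup S) \<le> (SUP x\<in>S. val x)"
  proof (rule ccontr)
    assume "\<not> ?thesis"
    then obtain r where r: "(SUP x\<in>S. val x) < of_rat r" "of_rat r < val (Sup S)"
      using of_rat_dense by (meson not_le)
    have "x \<le> dec_of_rat r" if "x \<in> S" for x
      using cSUP_upper[OF that bdd] r(1) val_mono[of "dec_of_rat r" x] linear[of x "dec_of_rat r"]
      by (auto simp: val_dec_of_rat)
    then have "Sup S \<le> dec_of_rat r" using assms by (intro cSup_least)
    then show False using val_mono r(2) val_dec_of_rat by fastforce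
  qed
qed

lemma val_Inf:
  assumes "S \<noteq> {}" "bdd_below S" shows "val (Inf S) = (INF x\<in>S. val x)"
proof (rule antisym)
  have bdd: "bdd_below (val ` S)"
    using assms by (auto simp: bdd_below_def intro: val_mono)
  show "val (Inf S) \<le> (INF x\<in>S. val x)"
    using assms by (intro cINF_greatest val_mono cInf_lower) auto
  show "(INF x\<in>S. val x) \<le> val (Inf S)"
  proof (rule ccontr)
    assume "\<not> ?thesis"
    then obtain r where r: "val (Inf S) < of_rat r" "of_rat r < (INF x\<in>S. val x)"
      using of_rat_dense by (meson not_le)
    have "dec_of_rat r \<le> x" if "x \<in> S" for x
      using cINF_lower[OF bdd that] r(2) val_mono[of x "dec_of_rat r"] linear[of x "dec_of_rat r"]
      by (auto simp: val_dec_of_rat)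
    then have "dec_of_rat r \<le> Inf S" using assms by (intro cInf_greatest)
    then show False using val_mono r(1) val_dec_of_rat by fastforce
  qed
qed


subsection \<open>Multiplication\<close>

lift_definition dec_psi :: "decimal \<Rightarrow> decimal" is
  "\<lambda>x k. if k = 0 then -1 - x 0 else 9 - x k"
  by auto

definition dec_norm :: "decimal \<Rightarrow> decimal" where
  "dec_norm x = max x (dec_psi x)"

lift_definition dec_zero :: decimal is "\<lambda>_. 0" by simp

lift_definition dec_neg_zero :: decimal is "\<lambda>k. if k = 0 then -1 else 9" by simp

text \<open>The second case amounts to \<open>x \<le> (-1).999\<dots>\<close>, see \<open>dec_sign_eq_1_iff\<close>.\<close>

definition dec_sign :: "decimal \<Rightarrow> nat" where
  "dec_sign x = (if dec_zero \<le> x then 0 else 1)"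

lemma scl_dec_zero [simp]: "scl dec_zero k = 0"
  by (induction k) (simp_all add: dec_zero.rep_eq)

lemma scl_dec_neg_zero [simp]: "scl dec_neg_zero k = -1"
  by (induction k) (simp_all add: dec_neg_zero.rep_eq)

lemma dec_sign_eq_1_iff: "dec_sign x = 1 \<longleftrightarrow> x \<le> dec_neg_zero"
proof -
  have "x \<le> dec_neg_zero" if "scl x k < 0" for k
    unfolding le_scl
  proof
    fix j
    have "scl x (max j k) < scl dec_zero (max j k)"
      by (rule scl_less_mono) (use that in auto)
    then have "scl x (max j k) \<le> scl dec_neg_zero (max j k)" by simp
    then show "scl x j \<le> scl dec_neg_zero j" by (rule scl_le_back) simp
  qed
  moreover have "scl x k < 0" if "x \<le> dec_neg_zero" for k
  proof -
    have "scl x k \<le> scl dec_neg_zero k" using that unfolding le_scl by blast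
    then show ?thesis by simp
  qed
  moreover have "dec_sign x = 1 \<longleftrightarrow> (\<exists>k. scl x k < 0)"
    by (simp add: dec_sign_def le_scl flip: not_le)
  ultimately show ?thesis by blast
qed

lemma scl_dec_psi: "scl (dec_psi x) k = - scl x k - 1"
  by (induction k) (simp_all add: dec_psi.rep_eq)

lemma val_dec_psi: "val (dec_psi x) = - val x"
proof (rule val_unique)
  fix k show "\<bar>- val x - of_int (scl (dec_psi x) k) / 10 ^ k\<bar> \<le> 1 / 10 ^ k"
    using val_lower[of x k] val_upper[of x k]
    by (simp add: scl_dec_psi diff_divide_distrib add_divide_distrib abs_le_iff)
qed

lemma val_dec_psi_funpow: "val ((dec_psi ^^ n) x) = (-1) ^ n * val x"
  by (induction n) (simp_all add: val_dec_psi)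

lemma val_dec_zero: "val dec_zero = 0"
  by (rule val_unique) simp

lemma val_dec_neg_zero: "val dec_neg_zero = 0"
  by (rule val_unique) simp

lemma val_dec_norm: "val (dec_norm x) = \<bar>val x\<bar>"
  using val_mono[of x "dec_psi x"] val_mono[of "dec_psi x" x]
  by (auto simp: dec_norm_def max_def val_dec_psi)

lemma dec_norm_nonneg: "dec_zero \<le> dec_norm x"
proof (cases "dec_zero \<le> x")
  case False
  then have "x \<le> dec_neg_zero" using dec_sign_eq_1_iff[of x] by (simp add: dec_sign_def)
  then have neg: "scl x k \<le> scl dec_neg_zero k" for k unfolding le_scl by blast
  have "0 \<le> - scl x k - 1" for k using neg[of k] by simp
  then have "dec_zero \<le> dec_psi x" unfolding le_scl scl_dec_psi scl_dec_zero by blast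
  then show ?thesis unfolding dec_norm_def by (simp add: le_max_iff_disj)
qed (simp add: dec_norm_def le_max_iff_disj)

lemma val_dec_sign: "(-1) ^ dec_sign x * \<bar>val x\<bar> = val x"
proof (cases "dec_zero \<le> x")
  case True
  then show ?thesis using val_mono[OF True] by (simp add: dec_sign_def val_dec_zero)
next
  case False
  then have "x \<le> dec_zero" by simp
  then show ?thesis using False val_mono[of x dec_zero] by (simp add: dec_sign_def val_dec_zero)
qed

definition dec_mult :: "decimal \<Rightarrow> decimal \<Rightarrow> decimal" (infixl "\<otimes>" 70) where
  "x \<otimes> y = (dec_psi ^^ (dec_sign x + dec_sign y))
    (LIMIT (\<lambda>k. dec_of_rat (trunc (dec_norm x) k * trunc (dec_norm y) k)))"

lemma of_rat_trunc: "of_rat (trunc x k) = (of_int (scl x k) / 10 ^ k :: real)"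
  by (simp add: trunc_scl of_rat_divide of_rat_power)

lemma trunc_mono: assumes "j \<le> k" shows "trunc x j \<le> trunc x k"
  using scl_frac_mono[OF assms, of x] unfolding of_rat_trunc[symmetric] of_rat_less_eq .

lemma trunc_bound: "trunc x k \<le> of_int (scl x 0 + 1)"
proof -
  have "real_of_rat (trunc x k) \<le> of_rat (of_int (scl x 0 + 1))"
    using scl_frac_le[of x k 0] by (simp add: of_rat_trunc of_rat_add)
  then show ?thesis unfolding of_rat_less_eq .
qed

lemma trunc_nonneg: assumes "dec_zero \<le> x" shows "0 \<le> trunc x k"
proof -
  have "scl dec_zero k \<le> scl x k" using assms unfolding le_scl by blast
  then show ?thesis by (simp add: trunc_scl)
qed

lemma
  assumes nn: "dec_zero \<le> x" "dec_zero \<le> y"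
  defines "X \<equiv> \<lambda>k. dec_of_rat (trunc x k * trunc y k)"
  shows LIMIT_product_exists: "LIMIT_upper X = LIMIT_lower X"
    and val_LIMIT_product: "val (LIMIT X) = val x * val y"
proof -
  define t where "t = (\<lambda>k. trunc x k * trunc y k)"
  define r where "r = (\<lambda>k. real_of_rat (t k))"
  define c :: rat where "c = of_int (scl x 0 + 1) * of_int (scl y 0 + 1)"
  have t_mono: "t j \<le> t k" if "j \<le> k" for j k
    unfolding t_def using that nn by (intro mult_mono trunc_mono trunc_nonneg) auto
  have t_bound: "t k \<le> c" for k
    unfolding t_def c_def using nn trunc_bound[of x k] trunc_bound[of y k]
      trunc_nonneg[of x k] trunc_nonneg[of y k]
    by (intro mult_mono) linarith+
  have X_eq: "X k = dec_of_rat (t k)" for k by (simp add: X_def t_def)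
  have X_mono: "X j \<le> X k" if "j \<le> k" for j k
    unfolding X_eq using that by (intro dec_of_rat_mono t_mono)
  have X_bound: "X k \<le> dec_of_rat c" for k
    unfolding X_eq by (intro dec_of_rat_mono t_bound)
  note lims = LIMIT_mono[of X "dec_of_rat c", OF X_mono X_bound]
  show "LIMIT_upper X = LIMIT_lower X"
    using lims(1,2) by simp
  have "{1..} = range Suc" by (auto simp: image_iff dest: Suc_le_D)
  then have "X ` {1..} = range (\<lambda>k. X (Suc k))" by (simp add: image_image)
  then have L: "LIMIT X = (SUP k. X (Suc k))" using lims(3) by simp
  have "val (LIMIT X) = (SUP k. r (Suc k))"
    unfolding L by (subst val_Sup)
      (auto simp: image_comp o_def X_eq val_dec_of_rat r_def X_bound[unfolded X_eq] intro!: bdd_aboveI2[of _ _ "dec_of_rat c"])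
  moreover have "(\<lambda>k. r (Suc k)) \<longlonglongrightarrow> (SUP k. r (Suc k))"
    by (rule LIMSEQ_incseq_SUP)
      (auto simp: incseq_def r_def of_rat_less_eq intro!: t_mono bdd_aboveI2[of _ _ "of_rat c"] t_bound)
  moreover have "r \<longlonglongrightarrow> val x * val y"
    unfolding r_def t_def of_rat_mult of_rat_trunc by (intro tendsto_mult scl_tendsto_val)
  then have "(\<lambda>k. r (Suc k)) \<longlonglongrightarrow> val x * val y" by (rule LIMSEQ_Suc)
  ultimately show "val (LIMIT X) = val x * val y" using LIMSEQ_unique by metis
qed

lemma val_dec_mult: "val (x \<otimes> y) = val x * val y"
proof -
  have "val (x \<otimes> y) = ((-1) ^ dec_sign x * \<bar>val x\<bar>) * ((-1) ^ dec_sign y * \<bar>val y\<bar>)"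
    by (simp add: dec_mult_def val_dec_psi_funpow val_LIMIT_product[OF dec_norm_nonneg dec_norm_nonneg]
        val_dec_norm power_add)
  then show ?thesis by (simp add: val_dec_sign)
qed

lift_definition dreal_mult :: "dreal \<Rightarrow> dreal \<Rightarrow> dreal" (infixl "\<otimes>\<^sub>R" 70) is dec_mult
  by (simp add: no_gap_iff_val val_dec_mult)


subsection \<open>Dedekind cuts\<close>

definition generalized_cut :: "rat set \<Rightarrow> rat set \<Rightarrow> bool" where
  "generalized_cut A B \<longleftrightarrow> A \<noteq> {} \<and> B \<noteq> {} \<and> A \<inter> B = {} \<and> A \<union> B = UNIV \<and> (\<forall>a\<in>A. \<forall>b\<in>B. a < b)"

definition is_greatest :: "rat \<Rightarrow> rat set \<Rightarrow> bool" where
  "is_greatest m A \<longleftrightarrow> m \<in> A \<and> (\<forall>a\<in>A. a \<le> m)"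

definition dedekind_cut :: "rat set \<Rightarrow> rat set \<Rightarrow> bool" where
  "dedekind_cut A B \<longleftrightarrow> generalized_cut A B \<and> \<not> (\<exists>m. is_greatest m A)"

lemma move_greatest_cut:
  assumes "generalized_cut A B"
  shows "dedekind_cut (A - {m. is_greatest m A}) (B \<union> {m. is_greatest m A})"
proof (cases "\<exists>m. is_greatest m A")
  case True
  then obtain m where m: "is_greatest m A" by blast
  then have G: "{m. is_greatest m A} = {m}" by (auto simp: is_greatest_def intro: antisym)
  have mA: "m \<in> A" "\<And>a. a \<in> A \<Longrightarrow> a \<le> m" using m by (auto simp: is_greatest_def)
  have inA: "x \<in> A" if "x < m" for x
  proof (rule ccontr)
    assume "x \<notin> A"
    then have "x \<in> B" using assms by (auto simp: generalized_cut_def)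
    then have "m < x" using assms mA by (simp add: generalized_cut_def)
    then show False using that by simp
  qed
  have "m - 1 \<in> A" by (rule inA) simp
  have "\<not> is_greatest k (A - {m})" for k
  proof
    assume k: "is_greatest k (A - {m})"
    then have "k \<le> m" "k \<noteq> m" using mA by (auto simp: is_greatest_def)
    then have less: "k < (k + m) / 2" "(k + m) / 2 < m" by simp_all
    then have "(k + m) / 2 \<in> A - {m}" using inA[OF less(2)] by auto
    then have "(k + m) / 2 \<le> k" using k unfolding is_greatest_def by blast
    then show False using less(1) by simp
  qed
  moreover have "generalized_cut (A - {m}) (B \<union> {m})"
  proof -
    have "A - {m} \<noteq> {}" using \<open>m - 1 \<in> A\<close> by auto
    moreover have "a < b" if "a \<in> A - {m}" "b \<in> B \<union> {m}" for a b
      using that assms mA(2)[of a] by (auto simp: generalized_cut_def)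
    ultimately show ?thesis using assms by (auto simp: generalized_cut_def)
  qed
  ultimately show ?thesis by (simp add: dedekind_cut_def G)
next
  case False
  then show ?thesis using assms by (simp add: dedekind_cut_def)
qed

typedef dcut = "{(A, B). dedekind_cut A B}"
  morphisms dcut_sets Abs_dcut
proof -
  have "generalized_cut {..0} {0<..}" by (auto simp: generalized_cut_def)
  then show ?thesis using move_greatest_cut by blast
qed

definition cut_lower :: "dcut \<Rightarrow> rat set" where "cut_lower c = fst (dcut_sets c)"

definition cut_upper :: "dcut \<Rightarrow> rat set" where "cut_upper c = snd (dcut_sets c)"

lemma dedekind_cut_lower_upper: "dedekind_cut (cut_lower c) (cut_upper c)"
  using dcut_sets[of c] by (auto simp: cut_lower_def cut_upper_def)

text \<open>The Dedekind cut with which a generalized Dedekind cut is identified: the greatest element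
  of the lower set, if there is one, is moved to the upper set. Meaningful only if
  \<^const>\<open>generalized_cut\<close> holds of the two arguments.\<close>

definition gcut :: "rat set \<Rightarrow> rat set \<Rightarrow> dcut" where
  "gcut A B = Abs_dcut (A - {m. is_greatest m A}, B \<union> {m. is_greatest m A})"

lemma lower_upper_gcut:
  assumes "generalized_cut A B"
  shows "cut_lower (gcut A B) = A - {m. is_greatest m A}" "cut_upper (gcut A B) = B \<union> {m. is_greatest m A}"
  using move_greatest_cut[OF assms] by (simp_all add: cut_lower_def cut_upper_def gcut_def Abs_dcut_inverse)

text \<open>The map to the reals, by the supremum of the lower set; by \<open>dcut_to_dreal_Inf\<close> below the
  infimum of the upper set defines the same class.\<close>

definition dcut_to_dreal :: "dcut \<Rightarrow> dreal" where
  "dcut_to_dreal c = dreal_class (Sup (dec_of_rat ` cut_lower c))"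

lemma Sup_lower_no_gap_Inf_upper:
  "no_gap (Sup (dec_of_rat ` cut_lower c)) (Inf (dec_of_rat ` cut_upper c))"
proof -
  have cut: "generalized_cut (cut_lower c) (cut_upper c)"
    using dedekind_cut_lower_upper by (simp add: dedekind_cut_def)
  then obtain a b where ab: "a \<in> cut_lower c" "b \<in> cut_upper c" by (auto simp: generalized_cut_def)
  have less: "x < y" if "x \<in> cut_lower c" "y \<in> cut_upper c" for x y
    using cut that by (simp add: generalized_cut_def)
  have bddA: "bdd_above (dec_of_rat ` cut_lower c)" "bdd_above (real_of_rat ` cut_lower c)"
    using less[OF _ ab(2)]
    by (auto intro!: bdd_aboveI2[of _ _ "dec_of_rat b"] bdd_aboveI2[of _ _ "of_rat b"] dec_of_rat_mono
        simp: of_rat_less_eq less_imp_le)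
  have bddB: "bdd_below (dec_of_rat ` cut_upper c)" "bdd_below (real_of_rat ` cut_upper c)"
    using less[OF ab(1)]
    by (auto intro!: bdd_belowI2[of _ "dec_of_rat a"] bdd_belowI2[of _ "of_rat a"] dec_of_rat_mono
        simp: of_rat_less_eq less_imp_le)
  have S: "val (Sup (dec_of_rat ` cut_lower c)) = Sup (real_of_rat ` cut_lower c)"
    using ab bddA(1) by (subst val_Sup) (auto simp: image_comp o_def val_dec_of_rat)
  have I: "val (Inf (dec_of_rat ` cut_upper c)) = Inf (real_of_rat ` cut_upper c)"
    using ab bddB(1) by (subst val_Inf) (auto simp: image_comp o_def val_dec_of_rat)
  have "Sup (real_of_rat ` cut_lower c) = Inf (real_of_rat ` cut_upper c)"
  proof (rule antisym)
    show "Sup (real_of_rat ` cut_lower c) \<le> Inf (real_of_rat ` cut_upper c)"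
      using ab less by (intro cSUP_least cINF_greatest) (auto simp: of_rat_less_eq less_imp_le)
    show "Inf (real_of_rat ` cut_upper c) \<le> Sup (real_of_rat ` cut_lower c)"
    proof (rule ccontr)
      assume "\<not> ?thesis"
      then obtain r where r: "Sup (real_of_rat ` cut_lower c) < of_rat r"
          "of_rat r < Inf (real_of_rat ` cut_upper c)"
        using of_rat_dense by (meson not_le)
      have "r \<in> cut_lower c \<or> r \<in> cut_upper c" using cut by (auto simp: generalized_cut_def)
      then show False
        using r cSUP_upper[OF _ bddA(2), of r] cINF_lower[OF bddB(2), of r] by auto
    qed
  qed
  then show ?thesis by (simp add: no_gap_iff_val S I)
qed

lemma dcut_to_dreal_Inf: "dcut_to_dreal c = dreal_class (Inf (dec_of_rat ` cut_upper c))"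
  unfolding dcut_to_dreal_def using Sup_lower_no_gap_Inf_upper
  by (simp add: dreal.abs_eq_iff)


subsection \<open>Multiplication of Dedekind cuts\<close>

definition dcut_psi :: "dcut \<Rightarrow> dcut" where
  "dcut_psi c = gcut (uminus ` cut_upper c) (uminus ` cut_lower c)"

lemma generalized_cut_uminus:
  assumes "generalized_cut A B" shows "generalized_cut (uminus ` B) (uminus ` A)"
proof -
  have "uminus ` B \<union> uminus ` A = uminus ` (A \<union> B)" by auto
  also have "\<dots> = (UNIV :: rat set)" using assms by (simp add: generalized_cut_def surj_uminus)
  finally show ?thesis using assms by (auto simp: generalized_cut_def)
qed

definition dcut_sign :: "dcut \<Rightarrow> nat" where
  "dcut_sign c = Max ((\<lambda>x. dec_sign (dec_of_rat x)) ` cut_upper c)"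

definition dcut_norm :: "dcut \<Rightarrow> dcut" where
  "dcut_norm c = (dcut_psi ^^ dcut_sign c) c"

text \<open>The product of two cuts of sign zero; meaningful for such cuts only (see
  \<open>generalized_cut_product\<close>), and used only on values of \<^const>\<open>dcut_norm\<close>, which have sign
  zero by \<open>dcut_sign_dcut_norm\<close>.\<close>

definition dcut_mult_nonneg :: "dcut \<Rightarrow> dcut \<Rightarrow> dcut" where
  "dcut_mult_nonneg c d =
    (let P = {x * y | x y. x \<in> cut_upper c \<and> y \<in> cut_upper d} in gcut (UNIV - P) P)"

definition dcut_mult :: "dcut \<Rightarrow> dcut \<Rightarrow> dcut" (infixl "\<boxtimes>" 70) where
  "c \<boxtimes> d = (dcut_psi ^^ (dcut_sign c + dcut_sign d)) (dcut_mult_nonneg (dcut_norm c) (dcut_norm d))"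

lemma dec_sign_of_rat: "dec_sign (dec_of_rat r) = (if 0 \<le> r then 0 else 1)"
proof -
  have "dec_zero \<le> dec_of_rat r \<longleftrightarrow> 0 \<le> r"
  proof
    assume "dec_zero \<le> dec_of_rat r"
    then have "val dec_zero \<le> val (dec_of_rat r)" by (rule val_mono)
    then show "0 \<le> r" by (simp add: val_dec_zero val_dec_of_rat)
  qed (simp add: le_scl scl_dec_of_rat)
  then show ?thesis by (simp add: dec_sign_def)
qed

lemma dcut_sign_eq_0_iff: "dcut_sign c = 0 \<longleftrightarrow> (\<forall>x\<in>cut_upper c. 0 \<le> x)"
proof -
  let ?S = "(\<lambda>x. dec_sign (dec_of_rat x)) ` cut_upper c"
  have fin: "finite ?S" by (rule finite_subset[of _ "{0, 1}"]) (auto simp: dec_sign_def)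
  have ne: "?S \<noteq> {}"
    using dedekind_cut_lower_upper[of c] by (simp add: dedekind_cut_def generalized_cut_def)
  have "dcut_sign c = 0 \<longleftrightarrow> Max ?S \<le> 0" unfolding dcut_sign_def by simp
  also have "\<dots> \<longleftrightarrow> (\<forall>x\<in>cut_upper c. 0 \<le> x)"
    unfolding Max_le_iff[OF fin ne] by (auto simp: dec_sign_of_rat)
  finally show ?thesis .
qed

lemma dcut_sign_le_1: "dcut_sign c \<le> 1"
proof -
  have "cut_upper c \<noteq> {}"
    using dedekind_cut_lower_upper[of c] by (simp add: dedekind_cut_def generalized_cut_def)
  moreover have "finite ((\<lambda>x. dec_sign (dec_of_rat x)) ` cut_upper c)"
    by (rule finite_subset[of _ "{0, 1}"]) (auto simp: dec_sign_def)
  ultimately show ?thesis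
    unfolding dcut_sign_def by (intro Max.boundedI) (auto simp: dec_sign_def)
qed

lemma generalized_cut_upward:
  assumes "generalized_cut A B" "b \<in> B" "b \<le> b'" shows "b' \<in> B"
proof (rule ccontr)
  assume "b' \<notin> B"
  then have "b' \<in> A" using assms(1) by (auto simp: generalized_cut_def)
  then have "b' < b" using assms by (simp add: generalized_cut_def)
  then show False using assms(3) by simp
qed

lemma generalized_cut_product:
  assumes c: "dcut_sign c = 0" and d: "dcut_sign d = 0"
  defines "P \<equiv> {x * y | x y. x \<in> cut_upper c \<and> y \<in> cut_upper d}"
  shows "generalized_cut (UNIV - P) P"
proof -
  have cut: "generalized_cut (cut_lower e) (cut_upper e)" for e
    using dedekind_cut_lower_upper by (simp add: dedekind_cut_def)
  have nn: "\<And>x. x \<in> cut_upper c \<Longrightarrow> 0 \<le> x" "\<And>y. y \<in> cut_upper d \<Longrightarrow> 0 \<le> y"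
    using c d dcut_sign_eq_0_iff by auto
  have up: "a \<in> P" if b: "b \<in> P" "b \<le> a" for a b
  proof -
    obtain x y where xy: "b = x * y" "x \<in> cut_upper c" "y \<in> cut_upper d"
      using b(1) by (auto simp: P_def)
    show "a \<in> P"
    proof (cases "x = 0")
      case True
      have "y + 1 \<in> cut_upper d" using xy(3) by (rule generalized_cut_upward[OF cut]) simp
      moreover have "a / (y + 1) \<in> cut_upper c"
        using xy(2) by (rule generalized_cut_upward[OF cut]) (use True b xy nn(2)[OF xy(3)] in simp)
      moreover have "a = a / (y + 1) * (y + 1)" using nn(2)[OF xy(3)] by simp
      ultimately show ?thesis unfolding P_def by blast
    next
      case False
      then have x: "x > 0" using nn(1)[OF xy(2)] by simp
      have "a / x \<in> cut_upper d"
        using xy(3) by (rule generalized_cut_upward[OF cut]) (use x b(2) xy(1) in \<open>simp add: le_divide_eq mult.commute\<close>)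
      moreover have "a = x * (a / x)" using x by simp
      ultimately show ?thesis unfolding P_def using xy(2) by blast
    qed
  qed
  have "cut_upper c \<noteq> {}" "cut_upper d \<noteq> {}" using cut by (auto simp: generalized_cut_def)
  then have "P \<noteq> {}" by (auto simp: P_def)
  moreover have "-1 \<notin> P"
  proof
    assume "-1 \<in> P"
    then obtain x y where xy: "-1 = x * y" "x \<in> cut_upper c" "y \<in> cut_upper d"
      unfolding P_def by blast
    then show False using mult_nonneg_nonneg[OF nn(1)[OF xy(2)] nn(2)[OF xy(3)]] by simp
  qed
  moreover have "a < b" if "a \<notin> P" "b \<in> P" for a b
    using up[OF that(2), of a] that(1) by (meson not_le)
  ultimately show ?thesis unfolding generalized_cut_def by blast
qed

lemma dcut_sign_dcut_norm: "dcut_sign (dcut_norm c) = 0"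
proof (cases "dcut_sign c = 0")
  case False
  then have sgn: "dcut_sign c = 1" using dcut_sign_le_1[of c] by simp
  obtain x where x: "x \<in> cut_upper c" "x < 0"
    using False dcut_sign_eq_0_iff[of c] by (auto simp: not_le)
  have cut: "generalized_cut (cut_lower c) (cut_upper c)"
    using dedekind_cut_lower_upper by (simp add: dedekind_cut_def)
  have "0 \<le> z" if "z \<in> cut_upper (dcut_psi c)" for z
  proof -
    have "z \<in> uminus ` cut_lower c \<or> is_greatest z (uminus ` cut_upper c)"
      using that lower_upper_gcut[OF generalized_cut_uminus[OF cut]] by (auto simp: dcut_psi_def)
    then show ?thesis
    proof
      assume "z \<in> uminus ` cut_lower c"
      then obtain a where "a \<in> cut_lower c" "z = - a" by blast
      then show ?thesis using cut x by (fastforce simp: generalized_cut_def)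
    next
      assume "is_greatest z (uminus ` cut_upper c)"
      then show ?thesis using x by (force simp: is_greatest_def)
    qed
  qed
  then show ?thesis by (simp add: dcut_norm_def sgn dcut_sign_eq_0_iff)
qed (simp add: dcut_norm_def)

end

theory Submission
  imports Defs
begin

text \<open>A cut is determined by the unique real number lying between its two sides, and \<open>\<tau>\<close> sends it
  to a formal decimal whose value is that number. Reflection of cuts negates this number, and for
  cuts of sign zero the products \<open>b d\<close> come arbitrarily close to the product of the two numbers
  from above, so the multiplication of cuts is multiplication of the separating numbers. The same
  holds for formal decimals and their values, and formal decimals without a gap are those with
  equal values.\<close>

text \<open>Both inequalities are weak, so the same notion serves Dedekind and generalized cuts and
  is carried over by reflection: negating and swapping the two sides negates
  \<open>v\<close>.\<close>

definition separates :: "real \<Rightarrow> rat set \<Rightarrow> rat set \<Rightarrow> bool" where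
  "separates v A B \<longleftrightarrow> (\<forall>a\<in>A. of_rat a \<le> v) \<and> (\<forall>b\<in>B. v \<le> of_rat b)"

definition cut_val :: "dcut \<Rightarrow> real" where
  "cut_val c = val (Sup (dec_of_rat ` cut_lower c))"

lemma generalized_cut_lower_upper: "generalized_cut (cut_lower c) (cut_upper c)"
  using dedekind_cut_lower_upper by (simp add: dedekind_cut_def)

text \<open>A rational strictly between two candidates would fit in neither side, although the sides
  exhaust the rationals.\<close>

lemma separates_unique:
  assumes "A \<union> B = UNIV" "separates v A B" "separates w A B"
  shows "v = w"
proof -
  have "\<not> v < w" if "separates v A B" "separates w A B" for v w
  proof
    assume "v < w"
    then obtain r where "v < of_rat r" "of_rat r < w" using of_rat_dense by blast
    moreover have "r \<in> A \<or> r \<in> B" using assms(1) by blast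
    ultimately show False using that by (auto simp: separates_def not_le[symmetric])
  qed
  then show ?thesis using assms(2,3) by (meson linorder_neqE)
qed

lemma separates_cut_val: "separates (cut_val c) (cut_lower c) (cut_upper c)"
proof -
  obtain a0 b0 where ab0: "a0 \<in> cut_lower c" "b0 \<in> cut_upper c"
    using generalized_cut_lower_upper[of c] by (auto simp: generalized_cut_def)
  have le: "dec_of_rat a \<le> dec_of_rat b" if "a \<in> cut_lower c" "b \<in> cut_upper c" for a b
    using generalized_cut_lower_upper[of c] that
    by (intro dec_of_rat_mono less_imp_le) (auto simp: generalized_cut_def)
  have bdd: "bdd_above (dec_of_rat ` cut_lower c)"
    using le[OF _ ab0(2)] by (rule bdd_aboveI2)
  have "val (dec_of_rat a) \<le> cut_val c" if "a \<in> cut_lower c" for a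
    unfolding cut_val_def using that bdd by (intro val_mono cSUP_upper)
  moreover have "cut_val c \<le> val (dec_of_rat b)" if "b \<in> cut_upper c" for b
    unfolding cut_val_def using ab0(1) le[OF _ that] by (intro val_mono cSUP_least) auto
  ultimately show ?thesis by (simp add: separates_def val_dec_of_rat)
qed

lemma cut_val_eqI: "separates v (cut_lower c) (cut_upper c) \<Longrightarrow> cut_val c = v"
  using separates_unique[OF _ separates_cut_val] generalized_cut_lower_upper[of c]
  by (simp add: generalized_cut_def)

text \<open>Only a greatest element \<open>m\<close> of \<open>A\<close> changes sides, so only
  \<open>v \<le> m\<close> needs proof: a rational strictly between \<open>m\<close> and
  \<open>v\<close> would have to lie in \<open>A\<close>, above its greatest element.\<close>

lemma cut_val_gcut:
  assumes cut: "generalized_cut A B" and sep: "separates v A B"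
  shows "cut_val (gcut A B) = v"
proof (rule cut_val_eqI)
  have "v \<le> of_rat m" if m: "is_greatest m A" for m
  proof (rule ccontr)
    assume "\<not> v \<le> of_rat m"
    then obtain r where r: "of_rat m < (of_rat r :: real)" "of_rat r < v"
      using of_rat_dense by (meson not_le)
    have "r \<notin> B" using sep r(2) by (auto simp: separates_def)
    then have "r \<in> A" using cut by (auto simp: generalized_cut_def)
    then have "r \<le> m" using m by (simp add: is_greatest_def)
    then show False using r(1) by (simp add: of_rat_less)
  qed
  then show "separates v (cut_lower (gcut A B)) (cut_upper (gcut A B))"
    using sep by (auto simp: lower_upper_gcut[OF cut] separates_def)
qed

lemma cut_val_dcut_psi: "cut_val (dcut_psi c) = - cut_val c"
  unfolding dcut_psi_def
  using separates_cut_val[of c]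
  by (intro cut_val_gcut generalized_cut_uminus generalized_cut_lower_upper)
    (auto simp: separates_def of_rat_minus)

lemma cut_val_dcut_psi_funpow: "cut_val ((dcut_psi ^^ n) c) = (-1) ^ n * cut_val c"
  by (induction n) (simp_all add: cut_val_dcut_psi)

text \<open>Otherwise a rational between the separating number and 0 would be a negative member of
  the upper set.\<close>

lemma cut_val_nonneg:
  assumes "dcut_sign c = 0"
  shows "0 \<le> cut_val c"
proof (rule ccontr)
  assume "\<not> 0 \<le> cut_val c"
  then obtain r where r: "cut_val c < of_rat r" "of_rat r < (0 :: real)"
    using of_rat_dense by (meson not_le)
  have "r \<notin> cut_lower c" using separates_cut_val[of c] r(1) by (auto simp: separates_def)
  then have "r \<in> cut_upper c" using generalized_cut_lower_upper[of c] by (auto simp: generalized_cut_def)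
  then show False using assms r(2) by (auto simp: dcut_sign_eq_0_iff)
qed

lemma cut_val_dcut_norm: "cut_val (dcut_norm c) = (-1) ^ dcut_sign c * cut_val c"
  by (simp add: dcut_norm_def cut_val_dcut_psi_funpow)

text \<open>Continuity at \<open>e = 0\<close> from the right; this gives the margin by which both
  factors may exceed their limits.\<close>

lemma exists_above_product_less:
  fixes v w a :: real
  assumes "v * w < a"
  shows "\<exists>e>0. (v + e) * (w + e) < a"
proof -
  have "((\<lambda>e. (v + e) * (w + e)) \<longlongrightarrow> (v + 0) * (w + 0)) (at_right 0)"
    by (intro tendsto_intros)
  then have "\<forall>\<^sub>F e in at_right 0. (v + e) * (w + e) < a"
    by (rule order_tendstoD) (use assms in simp)
  then have "\<forall>\<^sub>F e in at_right 0. 0 < e \<and> (v + e) * (w + e) < a"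
    using eventually_at_right_less[of 0] by eventually_elim simp
  then show ?thesis using eventually_happens'[OF trivial_limit_at_right_real] by blast
qed

lemma exists_upper_near:
  assumes "0 < e"
  shows "\<exists>x\<in>cut_upper c. of_rat x < cut_val c + e"
proof -
  obtain r where r: "cut_val c < of_rat r" "of_rat r < cut_val c + e"
    using of_rat_dense[of "cut_val c" "cut_val c + e"] assms by auto
  have "r \<notin> cut_lower c" using separates_cut_val[of c] r(1) by (auto simp: separates_def)
  then show ?thesis using generalized_cut_lower_upper[of c] r(2) by (auto simp: generalized_cut_def)
qed

lemma cut_val_dcut_mult_nonneg:
  assumes c: "dcut_sign c = 0" and d: "dcut_sign d = 0"
  shows "cut_val (dcut_mult_nonneg c d) = cut_val c * cut_val d"
proof -
  define P where "P = {x * y | x y. x \<in> cut_upper c \<and> y \<in> cut_upper d}"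
  have cut: "generalized_cut (UNIV - P) P"
    unfolding P_def by (rule generalized_cut_product[OF c d])
  have nn: "0 \<le> cut_val c" "0 \<le> cut_val d" using c d by (simp_all add: cut_val_nonneg)
  have lower: "cut_val e \<le> of_rat x" if "x \<in> cut_upper e" for e x
    using separates_cut_val[of e] that by (simp add: separates_def)
  have "cut_val c * cut_val d \<le> of_rat p" if p: "p \<in> P" for p
  proof -
    obtain x y where xy: "p = x * y" "x \<in> cut_upper c" "y \<in> cut_upper d"
      using p unfolding P_def by blast
    \<comment> \<open>Monotonicity of the product requires nonnegative factors; this is where sign
      zero enters.\<close>
    have "0 \<le> real_of_rat x" using nn(1) lower[OF xy(2)] by linarith
    then show ?thesis
      unfolding xy(1) of_rat_mult using nn xy(2,3) by (intro mult_mono lower)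
  qed
  moreover have "of_rat a \<le> cut_val c * cut_val d" if "a \<in> UNIV - P" for a
  proof (rule ccontr)
    assume "\<not> ?thesis"
    then obtain e where e: "0 < e" "(cut_val c + e) * (cut_val d + e) < of_rat a"
      using exists_above_product_less by (meson not_le)
    obtain x y where x: "x \<in> cut_upper c" "of_rat x < cut_val c + e"
      and y: "y \<in> cut_upper d" "of_rat y < cut_val d + e"
      using exists_upper_near[OF e(1)] by meson
    have "x * y \<in> P" unfolding P_def using x(1) y(1) by blast
    \<comment> \<open>Since \<open>P\<close> is the upper side of a cut, any one product bounds
      \<open>a\<close>; factors within \<open>e\<close> of the separating numbers then contradict
      the choice of \<open>e\<close>.\<close>
    then have "a < x * y" using cut that by (simp add: generalized_cut_def)
    then have "real_of_rat a < of_rat x * of_rat y" by (simp flip: of_rat_mult add: of_rat_less)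
    also have "\<dots> \<le> (cut_val c + e) * (cut_val d + e)"
      using x(2) y nn e(1) lower[OF y(1)] by (intro mult_mono) linarith+
    finally show False using e(2) by simp
  qed
  ultimately have "separates (cut_val c * cut_val d) (UNIV - P) P" by (simp add: separates_def)
  then show ?thesis
    unfolding dcut_mult_nonneg_def Let_def P_def[symmetric] by (rule cut_val_gcut[OF cut])
qed

text \<open>Each sign occurs twice, once in the norm and once in the outer reflections, so the
  powers of -1 cancel.\<close>

lemma cut_val_dcut_mult: "cut_val (c \<boxtimes> d) = cut_val c * cut_val d"
proof -
  have "cut_val (c \<boxtimes> d) = (-1) ^ (dcut_sign c + dcut_sign d)
      * (((-1) ^ dcut_sign c * cut_val c) * ((-1) ^ dcut_sign d * cut_val d))"
    by (simp add: dcut_mult_def cut_val_dcut_psi_funpow cut_val_dcut_mult_nonneg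
        dcut_sign_dcut_norm cut_val_dcut_norm)
  also have "\<dots> = ((-1) ^ dcut_sign c * (-1) ^ dcut_sign c) * ((-1) ^ dcut_sign d * (-1) ^ dcut_sign d)
      * (cut_val c * cut_val d)"
    by (simp add: power_add ac_simps)
  also have "\<dots> = cut_val c * cut_val d"
    by (simp flip: power_mult_distrib)
  finally show ?thesis .
qed

theorem theorem6p10:
  fixes c d :: dcut
  shows "dcut_to_dreal (c \<boxtimes> d) = dcut_to_dreal c \<otimes>\<^sub>R dcut_to_dreal d"
  \<comment> \<open>Equality of classes becomes equality of the values of their
    representatives.\<close>
  using cut_val_dcut_mult[of c d]
  by (simp add: dcut_to_dreal_def dreal_mult.abs_eq dreal.abs_eq_iff no_gap_iff_val val_dec_mult
      cut_val_def)

end
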